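(* For $n\in\mathbb{N}$ and $m,\mu\in\mathbb{N}_0$, one has $$D(n,m;\mu)=\begin{cases}H_{\mu}^{(m)}-\gamma(n,m;\mu), & \text{if } m>0,\\[4pt] n-\displaystyle\sum_{k=2}^{n}\zeta(k), & \text{if } m=0.\end{cases}$$
   Context: $\mathbb{N}=\{1,2,3,\dots\}$, $\mathbb{N}_0=\mathbb{N}\cup\{0\}$, and $\zeta$ is the Riemann zeta function. For $s_1,s_2\in\mathbb{C}$ with $s_1\notin\mathbb{Z}_{\le 0}$ and $\lambda\in\mathbb{C}$ with $\lambda\notin\mathbb{Z}_{<0}$, $$D(s_1,s_2;\lambda):=\sum_{k=1}^{\infty}\frac{\zeta(s_1+k)-1}{(k+\lambda)^{s_2}}.$$ For $\alpha,\beta\in\mathbb{C}$ with $\Re(\alpha)>0$ and $\mu\in\mathbb{N}_0$, the generalized Euler constant is $$\gamma(\alpha,\beta;\mu):=\lim_{N\to\infty}\left\{\sum_{l=1}^{\mu}\frac{1}{l^{\beta}}\sum_{k=1}^{N}\frac{1}{k^{\alpha+l-\mu}}-\sum_{k=2}^{N}\mathrm{Li}_{\beta}\!\left(\frac1k\right)k^{\mu-\alpha}\right\},$$ where $\mathrm{Li}_s(z)=\sum_{l=1}^{\infty}z^l/l^s$ is the polylogarithm; when $\mu=0$ the sum over $l$ from $1$ to $\mu$ is omitted. The generalized harmonic numbers are $H_{\mu}^{(m)}:=\sum_{k=1}^{\mu}k^{-m}$, with $H_0^{(m)}:=0$. Empty sums are $0$. *)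

theory Defs
  imports "HOL-Complex_Analysis.Complex_Analysis"
begin

text \<open>
  The Riemann zeta function: the Dirichlet series on the half-plane \<open>Re s > 1\<close>, and its analytic
  continuation to the complex plane without \<open>1\<close> elsewhere. By the identity theorem the
  continuation does not depend on the choice made by \<open>SOME\<close>, except for its value at the pole
  \<open>s = 1\<close>, which is meaningless.
\<close>

definition zeta_dirichlet :: "complex \<Rightarrow> complex" where
  "zeta_dirichlet s = (\<Sum>k. 1 / of_nat (Suc k) powr s)"

definition zeta :: "complex \<Rightarrow> complex" where
  "zeta s =
     (if Re s > 1 then zeta_dirichlet s
      else (SOME f. f holomorphic_on (- {1}) \<and> (\<forall>w. Re w > 1 \<longrightarrow> f w = zeta_dirichlet w)) s)"

text \<open>
  \<open>Dterm s1 s2 c i\<close> is the summand with index \<open>k = i + 1\<close> of the series \<open>D(s1, s2; c)\<close>, which is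
  meaningful when \<open>s1\<close> is not an integer \<open>\<le> 0\<close> and \<open>c\<close> is not an integer \<open>< 0\<close>. Complex powers are
  principal values.
\<close>

definition Dterm :: "complex \<Rightarrow> complex \<Rightarrow> complex \<Rightarrow> nat \<Rightarrow> complex" where
  "Dterm s1 s2 c i =
     (zeta (s1 + of_nat (Suc i)) - 1) / (of_nat (Suc i) + c) powr s2"

definition Dseries :: "complex \<Rightarrow> complex \<Rightarrow> complex \<Rightarrow> complex" where
  "Dseries s1 s2 c = (\<Sum>i. Dterm s1 s2 c i)"

definition polylog :: "complex \<Rightarrow> complex \<Rightarrow> complex" where
  "polylog s z = (\<Sum>i. z ^ Suc i / of_nat (Suc i) powr s)"

text \<open>The generalized Euler constant is meaningful when \<open>Re \<alpha> > 0\<close>.\<close>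

definition gen_euler_seq :: "complex \<Rightarrow> complex \<Rightarrow> nat \<Rightarrow> nat \<Rightarrow> complex" where
  "gen_euler_seq \<alpha> \<beta> \<mu> N =
     (\<Sum>l=1..\<mu>. 1 / of_nat l powr \<beta> * (\<Sum>k=1..N. 1 / of_nat k powr (\<alpha> + of_nat l - of_nat \<mu>)))
     - (\<Sum>k=2..N. polylog \<beta> (1 / of_nat k) * of_nat k powr (of_nat \<mu> - \<alpha>))"

definition gen_euler :: "complex \<Rightarrow> complex \<Rightarrow> nat \<Rightarrow> complex" where
  "gen_euler \<alpha> \<beta> \<mu> = lim (gen_euler_seq \<alpha> \<beta> \<mu>)"

definition gen_harm :: "nat \<Rightarrow> nat \<Rightarrow> complex" where
  "gen_harm m \<mu> = (\<Sum>k=1..\<mu>. of_nat k powi (- int m))"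

end

theory Submission imports Defs begin

text \<open>
  Expanding \<open>zeta (n + k) - 1 = (\<Sum>j\<ge>2. j\<^sup>-\<^sup>n\<^sup>-\<^sup>k)\<close> turns \<open>D(n, m; \<mu>)\<close> into a double series of
  nonnegative terms. Summing over \<open>k\<close> first leaves, for each \<open>j\<close>, the tail of \<open>Li\<^sub>m(1/j)\<close> beyond
  its first \<open>\<mu>\<close> terms, multiplied by \<open>j\<^sup>\<mu>\<^sup>-\<^sup>n\<close>; the partial sums of these over \<open>2 \<le> j \<le> N\<close> are the
  harmonic number minus the sequence defining the Euler constant, where the harmonic number
  compensates for the terms with \<open>j = 1\<close>. For \<open>m = 0\<close> one has \<open>D(n + 1) = D(n) - (zeta (n + 1) - 1)\<close>,
  and \<open>D(1)\<close> telescopes.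
\<close>

text \<open>Absorbing the factor k^(\<mu>-n) into the tail of Li_m(1/k) leaves only natural
  exponents, also when \<mu> < n. Real values give access to the order arguments below.\<close>

definition polylog_tail :: "nat \<Rightarrow> nat \<Rightarrow> nat \<Rightarrow> nat \<Rightarrow> real" where
  "polylog_tail n m \<mu> k = (\<Sum>i. 1 / (real k ^ (n + Suc i) * real (Suc i + \<mu>) ^ m))"

text \<open>Tonelli for series: nonnegativity turns each \<open>sums\<close> into the unordered
  \<open>has_sum\<close>, where pairs may be regrouped freely. Convergence of \<open>s\<close> is
  obtained along the way.\<close>

lemma sums_swap_nonneg:
  fixes a :: "nat \<Rightarrow> nat \<Rightarrow> real"
  assumes nonneg: "\<And>i j. a i j \<ge> 0"
    and rows: "\<And>i. a i sums s i"
    and cols: "\<And>j. (\<lambda>i. a i j) sums t j"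
    and total: "t sums T"
  shows "s sums T"
proof -
  have cols': "((\<lambda>i. a i j) has_sum t j) UNIV" for j
    using cols nonneg by (intro sums_nonneg_imp_has_sum) auto
  have rows': "((\<lambda>j. a i j) has_sum s i) UNIV" for i
    using rows nonneg by (intro sums_nonneg_imp_has_sum) auto
  have "t j \<ge> 0" for j
    using cols' nonneg by (meson has_sum_nonneg)
  then have total': "(t has_sum T) UNIV"
    using total by (intro sums_nonneg_imp_has_sum) auto
  \<comment> \<open>Regrouping requires joint summability; for nonnegative entries a finite iterated
    sum provides it.\<close>
  have "(\<lambda>(j, i). a i j) summable_on (UNIV \<times> UNIV)"
    using cols' total' nonneg by (intro summable_on_SigmaI[where g = t]) (auto simp: summable_on_def)
  then have "((\<lambda>(j, i). a i j) has_sum T) (UNIV \<times> UNIV)"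
    using cols' total' by (intro has_sum_SigmaI[where g = t]) auto
  then have "((\<lambda>(i, j). a i j) has_sum T) (UNIV \<times> UNIV)"
    by (subst (asm) has_sum_swap) (simp add: case_prod_unfold)
  then have "(s has_sum T) UNIV"
    by (rule has_sum_SigmaD) (use rows' in auto)
  then show ?thesis
    by (rule has_sum_imp_sums)
qed

text \<open>The bound on \<open>p\<close> selects the Dirichlet series branch of
  \<open>zeta\<close>; subtracting 1 removes its first term, so the bases start at 2.\<close>

lemma zeta_of_nat_minus_one:
  assumes "p \<ge> 2"
  shows "zeta (of_nat p) - 1 = of_real (\<Sum>j. 1 / real (j + 2) ^ p)"
    and "summable (\<lambda>j. 1 / real (j + 2) ^ p)"
proof -
  have sm: "summable (\<lambda>k. 1 / real (Suc k) ^ p)"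
    using inverse_power_summable[OF assms, where 'a = real]
    by (subst summable_Suc_iff) (simp add: inverse_eq_divide)
  then show "summable (\<lambda>j. 1 / real (j + 2) ^ p)"
    by (subst (asm) summable_Suc_iff[symmetric]) (simp add: add_ac numeral_2_eq_2)
  have "zeta (of_nat p) = (\<Sum>k. 1 / of_nat (Suc k) powr of_nat p)"
    using assms by (simp add: zeta_def zeta_dirichlet_def)
  also have "\<dots> = (\<Sum>k. of_real (1 / real (Suc k) ^ p))"
    by (intro suminf_cong) (simp add: powr_nat del: of_nat_Suc)
  also have "\<dots> = of_real (\<Sum>k. 1 / real (Suc k) ^ p)"
    by (rule suminf_of_real[OF sm, symmetric])
  also have "(\<Sum>k. 1 / real (Suc k) ^ p) = (\<Sum>j. 1 / real (j + 2) ^ p) + 1"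
    using suminf_split_head[OF sm] by (simp add: add_ac numeral_2_eq_2)
  finally show "zeta (of_nat p) - 1 = of_real (\<Sum>j. 1 / real (j + 2) ^ p)"
    by simp
qed

lemma polylog_terms_summable:
  assumes "k \<ge> 2"
  shows "summable (\<lambda>i. (1 / real k) ^ Suc i / real (Suc i) ^ m)"
proof (rule summable_comparison_test')
  show "summable (\<lambda>i. (1 / real k) ^ Suc i)"
    using assms by (subst summable_Suc_iff) (intro summable_geometric, simp)
  fix i :: nat
  show "norm ((1 / real k) ^ Suc i / real (Suc i) ^ m) \<le> (1 / real k) ^ Suc i"
  proof -
    have "real (Suc i) ^ m \<ge> 1" by simp
    moreover have "(1 / real k) ^ Suc i \<ge> 0" by simp
    ultimately have "(1 / real k) ^ Suc i / real (Suc i) ^ m \<le> (1 / real k) ^ Suc i / 1"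
      by (intro divide_left_mono) auto
    then show ?thesis by (simp del: of_nat_Suc)
  qed
qed

text \<open>Multiplying Li_m(1/k) by k^(\<mu>-n) turns its first \<mu> terms into exactly the
  summands of the double sum in \<open>gen_euler_seq\<close>. Subtracting them leaves the
  tail.\<close>

lemma polylog_tail_sums:
  assumes "k \<ge> 2"
  shows "(\<lambda>i. 1 / (real k ^ (n + Suc i) * real (Suc i + \<mu>) ^ m)) sums polylog_tail n m \<mu> k"
    and "of_real (polylog_tail n m \<mu> k) =
           polylog (of_nat m) (1 / of_nat k) * of_nat k powr (of_nat \<mu> - of_nat n) -
           (\<Sum>l=1..\<mu>. 1 / of_nat l powr of_nat m *
              (1 / of_nat k powr (of_nat n + of_nat l - of_nat \<mu>)))"
proof -
  define g where "g i = (1 / real k) ^ Suc i / real (Suc i) ^ m" for i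
  \<comment> \<open>A quotient of powers, since a truncated natural exponent would be wrong for
    \<mu> < n.\<close>
  define c where "c = real k ^ \<mu> / real k ^ n"
  have sm: "summable g"
    unfolding g_def by (rule polylog_terms_summable[OF assms])
  have "(\<lambda>i. g (i + \<mu>) * c) sums ((suminf g - (\<Sum>i<\<mu>. g i)) * c)"
    by (intro sums_mult2 sums_split_initial_segment summable_sums sm)
  also have "(\<lambda>i. g (i + \<mu>) * c) = (\<lambda>i. 1 / (real k ^ (n + Suc i) * real (Suc i + \<mu>) ^ m))"
    using assms by (auto simp: g_def c_def fun_eq_iff power_add field_simps)
  finally have tail: "(\<lambda>i. 1 / (real k ^ (n + Suc i) * real (Suc i + \<mu>) ^ m)) sums
      ((suminf g - (\<Sum>i<\<mu>. g i)) * c)" .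
  then have eq: "polylog_tail n m \<mu> k = (suminf g - (\<Sum>i<\<mu>. g i)) * c"
    unfolding polylog_tail_def by (rule sums_unique[symmetric])
  show "(\<lambda>i. 1 / (real k ^ (n + Suc i) * real (Suc i + \<mu>) ^ m)) sums polylog_tail n m \<mu> k"
    using tail eq by simp
  have "polylog (of_nat m) (1 / of_nat k) = (\<Sum>i. complex_of_real (g i))"
    unfolding polylog_def g_def by (intro suminf_cong) (simp add: powr_nat del: of_nat_Suc)
  then have li: "polylog (of_nat m) (1 / of_nat k) = complex_of_real (suminf g)"
    by (simp add: suminf_of_real[OF sm])
  have c: "complex_of_real c = of_nat k powr (of_nat \<mu> - of_nat n)"
    using assms by (simp add: c_def powr_diff powr_nat)
  have "complex_of_real (g i * c) = 1 / of_nat (Suc i) powr of_nat m *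
          (1 / of_nat k powr (of_nat n + of_nat (Suc i) - of_nat \<mu>))" for i
    using assms
    by (simp add: g_def c_def powr_diff powr_add powr_nat power_divide field_simps del: of_nat_Suc)
  then have "complex_of_real ((\<Sum>i<\<mu>. g i) * c) =
      (\<Sum>l=1..\<mu>. 1 / of_nat l powr of_nat m *
         (1 / of_nat k powr (of_nat n + of_nat l - of_nat \<mu>)))"
    by (simp add: sum_distrib_right sum.atLeast1_atMost_eq del: of_nat_Suc of_real_mult)
  then show "of_real (polylog_tail n m \<mu> k) =
           polylog (of_nat m) (1 / of_nat k) * of_nat k powr (of_nat \<mu> - of_nat n) -
           (\<Sum>l=1..\<mu>. 1 / of_nat l powr of_nat m *
              (1 / of_nat k powr (of_nat n + of_nat l - of_nat \<mu>)))"
    by (simp add: eq li c[symmetric] left_diff_distrib)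
qed

lemma gen_euler_seq_conv_polylog_tail:
  "gen_euler_seq (of_nat n) (of_nat m) \<mu> (Suc N) =
     gen_harm m \<mu> - of_real (\<Sum>j<N. polylog_tail n m \<mu> (j + 2))"
proof -
  let ?b = "\<lambda>l. 1 / of_nat l powr of_nat m :: complex"
  let ?e = "\<lambda>l k. 1 / of_nat k powr (of_nat n + of_nat l - of_nat \<mu>) :: complex"
  let ?p = "\<lambda>k. polylog (of_nat m) (1 / of_nat k) * of_nat k powr (of_nat \<mu> - of_nat n)"
  have harm: "gen_harm m \<mu> = (\<Sum>l=1..\<mu>. ?b l)"
    unfolding gen_harm_def
    by (intro sum.cong) (auto simp: powr_nat power_int_minus inverse_eq_divide)
  \<comment> \<open>The index \<open>Suc N\<close> ensures that k = 1 occurs. Its summand is 1 for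
    every l, and these unmatched ones produce the harmonic number.\<close>
  have split: "(\<Sum>k=1..Suc N. ?e l k) = 1 + (\<Sum>k=2..Suc N. ?e l k)" for l
    using sum.atLeast_Suc_atMost[of 1 "Suc N" "?e l"] by (simp add: numeral_2_eq_2)
  have "(\<Sum>l=1..\<mu>. ?b l * (\<Sum>k=1..Suc N. ?e l k)) =
        (\<Sum>l=1..\<mu>. ?b l + (\<Sum>k=2..Suc N. ?b l * ?e l k))"
    unfolding split by (simp only: distrib_left mult_1_right sum_distrib_left)
  also have "\<dots> = gen_harm m \<mu> + (\<Sum>k=2..Suc N. \<Sum>l=1..\<mu>. ?b l * ?e l k)"
    unfolding harm sum.distrib by (subst (2) sum.swap) simp
  finally have "gen_euler_seq (of_nat n) (of_nat m) \<mu> (Suc N) =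
      gen_harm m \<mu> - (\<Sum>k=2..Suc N. ?p k - (\<Sum>l=1..\<mu>. ?b l * ?e l k))"
    unfolding gen_euler_seq_def by (simp add: sum_subtractf)
  also have "(\<Sum>k=2..Suc N. ?p k - (\<Sum>l=1..\<mu>. ?b l * ?e l k)) =
      (\<Sum>k=2..Suc N. of_real (polylog_tail n m \<mu> k))"
    by (intro sum.cong refl polylog_tail_sums(2)[symmetric]) simp
  also have "\<dots> = of_real (\<Sum>j<N. polylog_tail n m \<mu> (j + 2))"
    unfolding of_real_sum
    by (rule sum.reindex_bij_witness[of _ "\<lambda>j. j + 2" "\<lambda>k. k - 2"])
      (auto simp del: add_2_eq_Suc')
  finally show ?thesis .
qed

text \<open>The entries j^-(n+k) (k+\<mu>)^-m give the terms of D when summed over j and the tails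
  when summed over k, so convergence of the tail series carries over to D.\<close>

lemma Dterm_sums:
  assumes "n \<ge> 1" and total: "(\<lambda>j. polylog_tail n m \<mu> (j + 2)) sums T"
  shows "Dterm (of_nat n) (of_nat m) (of_nat \<mu>) sums of_real T"
proof -
  define s where "s i = (\<Sum>j. 1 / real (j + 2) ^ (n + Suc i)) / real (Suc i + \<mu>) ^ m" for i
  have "Dterm (of_nat n) (of_nat m) (of_nat \<mu>) i = of_real (s i)" for i
  proof -
    have "n + Suc i \<ge> 2" using assms(1) by simp
    from zeta_of_nat_minus_one(1)[OF this] show ?thesis
      unfolding Dterm_def s_def of_nat_add[symmetric]
      by (simp add: powr_nat del: of_nat_Suc of_nat_add)
  qed
  moreover have "s sums T"
  proof (rule sums_swap_nonneg[OF _ _ _ total])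
    show "(\<lambda>j. 1 / (real (j + 2) ^ (n + Suc i) * real (Suc i + \<mu>) ^ m)) sums s i" for i
    proof -
      have "n + Suc i \<ge> 2" using assms(1) by simp
      from sums_divide[OF summable_sums[OF zeta_of_nat_minus_one(2)[OF this]]] show ?thesis
        unfolding s_def by simp
    qed
    show "(\<lambda>i. 1 / (real (j + 2) ^ (n + Suc i) * real (Suc i + \<mu>) ^ m)) sums
            polylog_tail n m \<mu> (j + 2)" for j
      by (rule polylog_tail_sums(1)) simp
  qed simp
  ultimately show ?thesis
    by (simp add: sums_of_real_iff cong: sums_cong)
qed

lemma telescoping_reciprocals_sums: "(\<lambda>j. 1 / (real (j + 1) * real (j + 2))) sums 1"
proof -
  have "(\<lambda>j. 1 / real (Suc j)) \<longlonglongrightarrow> 0"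
    using lim_1_over_n by (rule LIMSEQ_Suc)
  from telescope_sums'[OF this] show ?thesis
    by (simp add: field_simps)
qed

text \<open>For m = 0 the tail is geometric with ratio 1/k, whatever \<mu> is. This case serves
  twice: as a majorant for all tails and as the exact value behind D(1, 0; \<mu>).\<close>

lemma polylog_tail_one_zero:
  assumes "k \<ge> 2"
  shows "polylog_tail 1 0 \<mu> k = 1 / (real (k - 1) * real k)"
proof -
  have "(\<lambda>i. (1 / real k) ^ i * (1 / real k ^ 2)) sums (1 / (1 - 1 / real k) * (1 / real k ^ 2))"
    using assms by (intro sums_mult2 geometric_sums) simp
  also have "(\<lambda>i. (1 / real k) ^ i * (1 / real k ^ 2)) =
      (\<lambda>i. 1 / (real k ^ (1 + Suc i) * real (Suc i + \<mu>) ^ 0))"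
    by (simp add: fun_eq_iff power_divide power2_eq_square)
  also have "1 / (1 - 1 / real k) * (1 / real k ^ 2) = 1 / (real (k - 1) * real k)"
    using assms by (simp add: of_nat_diff field_simps power2_eq_square)
  finally show ?thesis
    using polylog_tail_sums(1)[OF assms] sums_unique2 by blast
qed

text \<open>Raising n from 1 or m from 0 only enlarges the denominators, so the geometric case
  dominates termwise.\<close>

lemma polylog_tail_le:
  assumes "n \<ge> 1" "k \<ge> 2"
  shows "0 \<le> polylog_tail n m \<mu> k" and "polylog_tail n m \<mu> k \<le> 1 / (real (k - 1) * real k)"
proof -
  show "0 \<le> polylog_tail n m \<mu> k"
    by (rule sums_le[OF _ sums_zero polylog_tail_sums(1)[OF assms(2)]]) simp
  have "1 / (real k ^ (n + Suc i) * real (Suc i + \<mu>) ^ m) \<le>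
      1 / (real k ^ (1 + Suc i) * real (Suc i + \<mu>) ^ 0)" for i
  proof -
    have "real k ^ (1 + Suc i) \<le> real k ^ (n + Suc i)"
      using assms by (intro power_increasing) auto
    moreover have "1 \<le> real (Suc i + \<mu>) ^ m" by simp
    ultimately have "real k ^ (1 + Suc i) * 1 \<le> real k ^ (n + Suc i) * real (Suc i + \<mu>) ^ m"
      by (intro mult_mono) auto
    then show ?thesis
      using assms by (intro divide_left_mono) auto
  qed
  then have "polylog_tail n m \<mu> k \<le> polylog_tail 1 0 \<mu> k"
    by (intro sums_le[OF _ polylog_tail_sums(1) polylog_tail_sums(1)] assms)
  then show "polylog_tail n m \<mu> k \<le> 1 / (real (k - 1) * real k)"
    by (simp only: polylog_tail_one_zero[OF assms(2)])
qed

lemma summable_polylog_tail: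
  assumes "n \<ge> 1"
  shows "summable (\<lambda>j. polylog_tail n m \<mu> (j + 2))"
proof (rule summable_comparison_test'[OF sums_summable[OF telescoping_reciprocals_sums]])
  fix j :: nat
  show "norm (polylog_tail n m \<mu> (j + 2)) \<le> 1 / (real (j + 1) * real (j + 2))"
    using polylog_tail_le[OF assms, of "j + 2" m \<mu>] by simp
qed

lemma Dterm_exponent_zero:
  "Dterm (of_nat n) 0 (of_nat \<mu>) = (\<lambda>i. zeta (of_nat (n + Suc i)) - 1)"
proof
  fix i
  \<comment> \<open>Since \<open>0 powr 0 = 0\<close>, the denominator reduces to 1 only for a
    nonzero base.\<close>
  have "of_nat (Suc i) + of_nat \<mu> \<noteq> (0 :: complex)"
    by (metis add_Suc of_nat_add of_nat_eq_0_iff nat.distinct(1))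
  then show "Dterm (of_nat n) 0 (of_nat \<mu>) i = zeta (of_nat (n + Suc i)) - 1"
    by (simp add: Dterm_def powr_def del: of_nat_Suc add_Suc_right)
qed

lemma zeta_minus_one_sums:
  assumes "n \<ge> 1"
  shows "(\<lambda>i. zeta (of_nat (n + Suc i)) - 1) sums (of_nat n - (\<Sum>k=2..n. zeta (of_nat k)))"
  using assms
proof (induction n rule: dec_induct)
  case base
  have "(\<lambda>j. polylog_tail 1 0 0 (j + 2)) sums 1"
    using telescoping_reciprocals_sums by (subst polylog_tail_one_zero) simp_all
  from Dterm_sums[OF order_refl this] show ?case
    using Dterm_exponent_zero[of 1 0] by simp
next
  case (step n)
  \<comment> \<open>Passing to \<open>Suc n\<close> drops the term i = 0; subtracting zeta(n+1) - 1
    from the value raises n by 1 and extends the sum of zeta values.\<close>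
  have "(\<lambda>i. zeta (of_nat (n + Suc (Suc i))) - 1) sums
      (of_nat n - (\<Sum>k=2..n. zeta (of_nat k)) - (zeta (of_nat (n + Suc 0)) - 1))"
    using step.IH by (subst sums_Suc_iff) simp
  moreover have "(\<Sum>k=2..Suc n. zeta (of_nat k)) =
      (\<Sum>k=2..n. zeta (of_nat k)) + zeta (of_nat (Suc n))"
    using step.hyps by simp
  ultimately show ?case
    by (simp add: algebra_simps)
qed

theorem theorem2p2:
  fixes n m \<mu> :: nat
  assumes "n \<ge> 1"
  shows "summable (Dterm (of_nat n) (of_nat m) (of_nat \<mu>)) \<and>
         (m > 0 \<longrightarrow> convergent (gen_euler_seq (of_nat n) (of_nat m) \<mu>)) \<and>
         Dseries (of_nat n) (of_nat m) (of_nat \<mu>) =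
           (if m > 0 then gen_harm m \<mu> - gen_euler (of_nat n) (of_nat m) \<mu>
            else of_nat n - (\<Sum>k=2..n. zeta (of_nat k)))"
proof -
  \<comment> \<open>One number links both sides: \<open>T\<close> is the value of D, and
    \<open>gen_harm m \<mu>\<close> minus \<open>T\<close> is the limit of the Euler
    sequence.\<close>
  obtain T where T: "(\<lambda>j. polylog_tail n m \<mu> (j + 2)) sums T"
    using summable_polylog_tail[OF assms] by (auto simp: summable_def)
  note D = Dterm_sums[OF assms T]
  have "(\<lambda>N. gen_euler_seq (of_nat n) (of_nat m) \<mu> (Suc N)) \<longlonglongrightarrow> gen_harm m \<mu> - of_real T"
    unfolding gen_euler_seq_conv_polylog_tail
    using T by (intro tendsto_intros) (simp add: sums_def)
  then have lim: "gen_euler_seq (of_nat n) (of_nat m) \<mu> \<longlonglongrightarrow> gen_harm m \<mu> - of_real T"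
    by (simp only: filterlim_sequentially_Suc)
  have "Dseries (of_nat n) (of_nat m) (of_nat \<mu>) =
      of_nat n - (\<Sum>k=2..n. zeta (of_nat k))" if "m = 0"
    using zeta_minus_one_sums[OF assms] that
    by (simp only: Dseries_def Dterm_exponent_zero of_nat_0 sums_iff)
  then show ?thesis
    using D lim by (auto simp: Dseries_def gen_euler_def sums_iff convergent_def limI)
qed

end
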